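(* For every integer $n\ge 0$, the polynomial $L_n(X,Y)$ is the image of the $n$th generalized Lucas polynomial $V_n(X,Y)$ under the substitution $Y\mapsto -Y$; that is, $L_n(X,Y)=V_n(X,-Y)$ in $\mathbb{Z}[X,Y]$.
   Context: For each integer $n\ge 0$, $L_n(X,Y)\in\mathbb{Z}[X,Y]$ denotes the unique polynomial with integer coefficients such that $L_n(a+b,ab)=a^n+b^n$ holds as an identity in $\mathbb{Z}[a,b]$, where $a,b$ are indeterminates. (Existence and uniqueness are given by the fundamental theorem on symmetric polynomials in two indeterminates.) The generalized Lucas polynomials $V_n(X,Y)\in\mathbb{Z}[X,Y]$ are defined by $V_0=2$, $V_1=X$, and $V_n=X\,V_{n-1}+Y\,V_{n-2}$ for $n\ge 2$. *)

theory Defs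
  imports "HOL-Computational_Algebra.Computational_Algebra"
begin

text \<open>
  The ring of integer polynomials in two commuting indeterminates is represented as
  \<^typ>\<open>int poly poly\<close>, i.e. as polynomials in the second indeterminate whose coefficients are
  polynomials in the first one. The same type serves for the indeterminates \<open>X, Y\<close> and for \<open>a, b\<close>.
\<close>

definition indet1 :: "int poly poly"
  where "indet1 = [:[:0, 1:]:]"

definition indet2 :: "int poly poly"
  where "indet2 = [:0, 1:]"

text \<open>\<open>subst2 P x y\<close> is \<open>P(x, y)\<close> for elements \<open>x, y\<close> of an arbitrary commutative ring.\<close>

definition subst2 :: "int poly poly \<Rightarrow> 'a::comm_ring_1 \<Rightarrow> 'a \<Rightarrow> 'a"
  where "subst2 P x y = poly (map_poly (\<lambda>p. poly (map_poly of_int p) x) P) y"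

lemma subst2_0 [simp]: "subst2 0 x y = 0"
  by (simp add: subst2_def)

lemma subst2_pCons [simp]:
  "subst2 (pCons p P) x y = poly (map_poly of_int p) x + y * subst2 P x y"
  by (simp add: subst2_def map_poly_pCons)

lemma subst2_1 [simp]: "subst2 1 x y = 1"
  unfolding one_pCons by (simp add: map_poly_pCons)

lemma subst2_indet1 [simp]: "subst2 indet1 x y = x"
  by (simp add: indet1_def map_poly_pCons)

lemma subst2_indet2 [simp]: "subst2 indet2 x y = y"
  by (simp add: indet2_def map_poly_pCons)

lemma subst2_add [simp]: "subst2 (P + Q) x y = subst2 P x y + subst2 Q x y"
proof -
  have inner: "poly (map_poly of_int (p + q)) x
      = poly (map_poly of_int p) x + poly (map_poly of_int q) x" for p q :: "int poly"
    by (induction p q rule: poly_induct2) (simp_all add: map_poly_pCons algebra_simps)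
  show ?thesis
    by (induction P Q rule: poly_induct2) (simp_all add: inner algebra_simps)
qed

lemma subst2_mult [simp]: "subst2 (P * Q) x y = subst2 P x y * subst2 Q x y"
proof -
  have add: "poly (map_poly of_int (p + q)) x
      = poly (map_poly of_int p) x + poly (map_poly of_int q) x" for p q :: "int poly"
    by (induction p q rule: poly_induct2) (simp_all add: map_poly_pCons algebra_simps)
  have smult: "poly (map_poly of_int (smult c q)) x = of_int c * poly (map_poly of_int q) x"
    for c :: int and q
    by (induction q) (simp_all add: map_poly_pCons algebra_simps)
  have mult: "poly (map_poly of_int (p * q)) x
      = poly (map_poly of_int p) x * poly (map_poly of_int q) x" for p q :: "int poly"
    by (induction p) (simp_all add: add smult map_poly_pCons algebra_simps)
  have smult2: "subst2 (smult p Q) x y = poly (map_poly of_int p) x * subst2 Q x y" for p Q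
    by (induction Q) (simp_all add: mult algebra_simps)
  show ?thesis
    by (induction P) (simp_all add: smult2 algebra_simps)
qed

text \<open>
  Existence and uniqueness of the polynomial \<open>L\<^sub>n\<close> described here are given by the fundamental
  theorem on symmetric polynomials in two indeterminates.
\<close>

definition symm_power_sum_poly :: "nat \<Rightarrow> int poly poly"
  where "symm_power_sum_poly n =
    (THE P. subst2 P (indet1 + indet2) (indet1 * indet2) = indet1 ^ n + indet2 ^ n)"

fun gen_lucas :: "nat \<Rightarrow> int poly poly"
  where
    "gen_lucas 0 = 2"
  | "gen_lucas (Suc 0) = indet1"
  | "gen_lucas (Suc (Suc n)) = indet1 * gen_lucas (Suc n) + indet2 * gen_lucas n"

end

theory Submission
  imports Defs
begin

text \<open>
  The polynomial defined by a description is identified by checking that \<open>V\<^sub>n(X, -Y)\<close> meets the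
  description and that at most one polynomial does. For the first point, \<open>a\<close> and \<open>b\<close> are the roots
  of \<open>t\<^sup>2 - (a + b) t + a b\<close>, so the power sums \<open>a\<^sup>n + b\<^sup>n\<close> obey the linear recurrence with
  coefficients \<open>a + b\<close> and \<open>-a b\<close>; this is the Lucas recurrence at \<open>X = a + b\<close>, \<open>Y = -a b\<close>
  (\<open>subst2_gen_lucas_neg\<close>). The second point is the algebraic independence of the elementary
  symmetric polynomials \<open>a + b\<close> and \<open>a b\<close> (\<open>subst2_elementary_symmetric_inject\<close>), proved by
  setting \<open>b = 0\<close> to read off the part of a polynomial free of \<open>Y\<close> and then cancelling \<open>a b\<close>.
\<close>

lemma subst2_minus: "subst2 (- P) x y = - subst2 P x y"
proof -
  have "subst2 (- P) x y + subst2 P x y = subst2 (- P + P) x y"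
    by (simp only: subst2_add)
  then show ?thesis
    by (simp add: eq_neg_iff_add_eq_0)
qed

lemma subst2_diff: "subst2 (P - Q) x y = subst2 P x y - subst2 Q x y"
  using subst2_add [of P "- Q" x y] by (simp add: subst2_minus)

lemma subst2_2: "subst2 2 x y = 2"
  using subst2_add [of 1 1 x y] by simp

text \<open>
  The identity \<open>a\<^sup>n\<^sup>+\<^sup>2 + b\<^sup>n\<^sup>+\<^sup>2 = (a + b) (a\<^sup>n\<^sup>+\<^sup>1 + b\<^sup>n\<^sup>+\<^sup>1) - a b (a\<^sup>n + b\<^sup>n)\<close> drives the induction. The sign
  in front of \<open>a b\<close> is why \<open>Y\<close> has to be negated.
\<close>

lemma subst2_gen_lucas_neg:
  "subst2 (subst2 (gen_lucas n) indet1 (- indet2)) (a + b) (a * b) = a ^ n + b ^ n"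
proof (induction n rule: gen_lucas.induct)
  case (3 n)
  let ?V = "\<lambda>m. subst2 (subst2 (gen_lucas m) indet1 (- indet2)) (a + b) (a * b)"
  have "?V (Suc (Suc n)) = (a + b) * ?V (Suc n) - a * b * ?V n"
    by (simp add: subst2_diff mult.assoc)
  also have "\<dots> = a ^ Suc (Suc n) + b ^ Suc (Suc n)"
    unfolding 3 by (simp add: algebra_simps)
  finally show ?case .
qed (simp_all add: subst2_2)

lemma poly_map_poly_of_int_at_0:
  fixes p :: "int poly" and z :: "int poly poly"
  shows "poly (poly (map_poly of_int p) z) 0 = poly (map_poly of_int p) (poly z 0)"
proof (induction p)
  case (pCons c p)
  have "poly (of_int c :: int poly poly) 0 = of_int c"
    by (simp add: of_int_poly)
  with pCons show ?case
    by (simp add: map_poly_pCons)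
qed simp

lemma poly_map_poly_of_int_indet:
  fixes p :: "int poly"
  shows "poly (map_poly of_int p) [:0, 1:] = p"
  by (induction p) (simp_all add: map_poly_pCons of_int_poly)

text \<open>
  Write \<open>P = p(X) + Y P'\<close>. At \<open>b = 0\<close> the value \<open>P(a + b, a b)\<close> becomes \<open>p(a)\<close>, so it determines \<open>p\<close>;
  what remains is \<open>a b P'(a + b, a b)\<close>, where \<open>a b\<close> cancels because \<open>\<int>[a, b]\<close> is an integral
  domain.
\<close>

lemma subst2_elementary_symmetric_inject:
  assumes "subst2 P (indet1 + indet2) (indet1 * indet2) =
    subst2 Q (indet1 + indet2) (indet1 * indet2)"
  shows "P = Q"
  using assms
proof (induction P Q rule: poly_induct2)
  case (pCons p P q Q)
  let ?s = "indet1 + indet2" and ?t = "indet1 * indet2"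
  have eq: "poly (map_poly of_int p) ?s + ?t * subst2 P ?s ?t =
      poly (map_poly of_int q) ?s + ?t * subst2 Q ?s ?t"
    using pCons.prems by simp
  have s0: "poly ?s 0 = [:0, 1:]" and t0: "poly ?t 0 = 0"
    by (simp_all add: indet1_def indet2_def)
  have at_0: "poly (poly (map_poly of_int r) ?s + ?t * R) 0 = r" for r :: "int poly" and R
    unfolding poly_add [of _ "?t * R"] poly_mult [of ?t] poly_map_poly_of_int_at_0 s0 t0
    by (simp add: poly_map_poly_of_int_indet)
  have "p = q"
    using arg_cong [OF eq, of "\<lambda>r. poly r 0"] unfolding at_0 .
  moreover have "?t \<noteq> 0"
    by (simp add: indet1_def indet2_def)
  ultimately have "subst2 P ?s ?t = subst2 Q ?s ?t"
    using eq by (simp only: add_left_cancel mult_cancel_left simp_thms)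
  with pCons.IH \<open>p = q\<close> show ?case
    by simp
qed simp

theorem proposition3:
  fixes n :: nat
  shows "symm_power_sum_poly n = subst2 (gen_lucas n) indet1 (- indet2)"
  unfolding symm_power_sum_poly_def
proof (rule the_equality)
  show "subst2 (subst2 (gen_lucas n) indet1 (- indet2)) (indet1 + indet2) (indet1 * indet2) =
      indet1 ^ n + indet2 ^ n"
    by (rule subst2_gen_lucas_neg)
next
  fix P
  assume "subst2 P (indet1 + indet2) (indet1 * indet2) = indet1 ^ n + indet2 ^ n"
  then show "P = subst2 (gen_lucas n) indet1 (- indet2)"
    by (subst (asm) subst2_gen_lucas_neg [symmetric]) (rule subst2_elementary_symmetric_inject)
qed

end
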